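(* Let $X=\{X_1,\dots,X_n\}$ be a finite set of letters and let $\tau$ be a positive trace on the $*$-algebra $\mathbb{C}\langle X\rangle$. Then there is a sequence of positive traces $(\tau_k)_{k\in\mathbb{N}}$ on $\mathbb{C}\langle X\rangle$, converging to $\tau$ pointwise on $\mathbb{C}\langle X\rangle$, such that each $\tau_k$ vanishes on $J_k$.
   Context: $\mathbb{C}\langle X\rangle$ is the algebra of non-commutative polynomials in $X_1,\dots,X_n$ over $\mathbb{C}$, with the involution determined by $X_i^*=X_i$ and $\lambda^*=\overline{\lambda}$ for $\lambda\in\mathbb{C}$. A positive trace on a unital complex $*$-algebra $A$ is a $\mathbb{C}$-linear functional $\tau\colon A\to\mathbb{C}$ with $\tau(1)=1$, $\tau(a^*a)\ge0$ and $\tau(ab)=\tau(ba)$ for all $a,b\in A$. For $k\ge1$, $J_k\subset\mathbb{C}\langle X\rangle$ is the two-sided $*$-ideal of all $P$ such that $P(a_1,\dots,a_n)=0$ for all self-adjoint complex $k\times k$-matrices $a_1,\dots,a_n$. Here $\mathbb{N}=\{1,2,\dots\}$. *)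

theory Defs
  imports
    "HOL-Analysis.Analysis"
    "HOL-Library.Poly_Mapping"
    "HOL-Library.Complex_Order"
    "Jordan_Normal_Form.Matrix"
    "Jordan_Normal_Form.Schur_Decomposition"
begin

section \<open>Unital complex \<open>*\<close>-algebras and positive traces\<close>

locale complex_star_algebra = vector_space scale
  for scale :: "complex \<Rightarrow> 'a::ring_1 \<Rightarrow> 'a" +
  fixes star :: "'a \<Rightarrow> 'a"
  assumes scale_mult_left: "scale c a * b = scale c (a * b)"
    and scale_mult_right: "a * scale c b = scale c (a * b)"
    and star_add: "star (a + b) = star a + star b"
    and star_scale: "star (scale c a) = scale (cnj c) (star a)"
    and star_mult: "star (a * b) = star b * star a"
    and star_star: "star (star a) = a"
begin

text \<open>In the order on \<^typ>\<open>complex\<close> used here, \<open>0 \<le> z\<close> means that \<open>z\<close> is a nonnegative real.\<close>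

definition positive_trace :: "('a \<Rightarrow> complex) \<Rightarrow> bool" where
  "positive_trace \<tau> \<longleftrightarrow>
     Vector_Spaces.linear scale (*) \<tau> \<and>
     \<tau> 1 = 1 \<and>
     (\<forall>a. 0 \<le> \<tau> (star a * a)) \<and>
     (\<forall>a b. \<tau> (a * b) = \<tau> (b * a))"

end


section \<open>Non-commutative polynomials\<close>

text \<open>The free monoid on the letters \<^typ>\<open>'x\<close>, written additively so that the convolution product
  on \<open>\<Rightarrow>\<^sub>0\<close> makes the finitely supported functions on words the free algebra.\<close>

datatype 'x word = Word (letters: "'x list")

instantiation word :: (type) monoid_add
begin

definition zero_word :: "'a word" where "0 = Word []"

definition plus_word :: "'a word \<Rightarrow> 'a word \<Rightarrow> 'a word" where
  "u + v = Word (letters u @ letters v)"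

instance
  by standard (simp_all add: zero_word_def plus_word_def)

end

type_synonym 'x ncpoly = "'x word \<Rightarrow>\<^sub>0 complex"

definition nc_var :: "'x \<Rightarrow> 'x ncpoly" where
  "nc_var x = Poly_Mapping.single (Word [x]) 1"

definition nc_scale :: "complex \<Rightarrow> 'x ncpoly \<Rightarrow> 'x ncpoly" where
  "nc_scale c P = Poly_Mapping.map ((*) c) P"

definition word_rev :: "'x word \<Rightarrow> 'x word" where
  "word_rev w = Word (rev (letters w))"

definition nc_star :: "'x ncpoly \<Rightarrow> 'x ncpoly" where
  "nc_star P = Poly_Mapping.map cnj (Poly_Mapping.map_key word_rev P)"

lemma word_rev_word_rev [simp]: "word_rev (word_rev w) = w"
  by (simp add: word_rev_def)

lemma word_rev_add: "word_rev (u + v) = word_rev v + word_rev u"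
  by (simp add: word_rev_def plus_word_def)

lemma word_rev_zero [simp]: "word_rev 0 = 0"
  by (simp add: word_rev_def zero_word_def)

lemma inj_word_rev: "inj word_rev"
  by (metis injI word_rev_word_rev)

lemma lookup_nc_scale [simp]:
  "Poly_Mapping.lookup (nc_scale c P) w = c * Poly_Mapping.lookup P w"
  by (simp add: nc_scale_def Poly_Mapping.map.rep_eq when_def)

lemma lookup_nc_star [simp]:
  "Poly_Mapping.lookup (nc_star P) w = cnj (Poly_Mapping.lookup P (word_rev w))"
  by (simp add: nc_star_def Poly_Mapping.map.rep_eq map_key.rep_eq[OF inj_word_rev] when_def)

lemma nc_scale_conv_mult: "nc_scale c P = Poly_Mapping.single 0 c * P"
  by (simp add: nc_scale_def mult_map_scale_conv_mult)

lemma ncpoly_sum_monomials: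
  "(\<Sum>w\<in>Poly_Mapping.keys P. Poly_Mapping.single w (Poly_Mapping.lookup P w)) = P"
  by (rule poly_mapping_eqI)
    (simp add: lookup_sum lookup_single when_def in_keys_iff)

lemma nc_scale_mult_right: "P * nc_scale c Q = nc_scale c (P * Q)"
proof -
  define f where "f w = Poly_Mapping.single w (Poly_Mapping.lookup P w)" for w
  have "sum f A * Poly_Mapping.single 0 c = Poly_Mapping.single 0 c * sum f A" for A
    by (simp add: f_def sum_distrib_left sum_distrib_right mult_single mult.commute)
  then have "P * Poly_Mapping.single 0 c = Poly_Mapping.single 0 c * P"
    using ncpoly_sum_monomials[of P] unfolding f_def by metis
  then show ?thesis
    by (metis mult.assoc nc_scale_conv_mult)
qed

lemma nc_star_single:
  "nc_star (Poly_Mapping.single w c) = Poly_Mapping.single (word_rev w) (cnj c)"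
  by (rule poly_mapping_eqI) (auto simp: lookup_single when_def)

lemma nc_star_add: "nc_star (P + Q) = nc_star P + nc_star Q"
  by (rule poly_mapping_eqI) (simp add: lookup_add)

lemma nc_star_sum: "nc_star (sum f A) = (\<Sum>x\<in>A. nc_star (f x))"
proof (induction A rule: infinite_finite_induct)
  case empty
  then show ?case by (auto intro: poly_mapping_eqI)
next
  case infinite
  then show ?case by (auto intro: poly_mapping_eqI)
qed (simp add: nc_star_add)

lemma nc_star_mult: "nc_star (P * Q) = nc_star Q * nc_star P"
proof -
  define f g where "f w = Poly_Mapping.single w (Poly_Mapping.lookup P w)"
    and "g w = Poly_Mapping.single w (Poly_Mapping.lookup Q w)" for w
  have P: "P = sum f (Poly_Mapping.keys P)" and Q: "Q = sum g (Poly_Mapping.keys Q)"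
    by (simp_all add: f_def g_def ncpoly_sum_monomials)
  have fg: "nc_star (f u * g v) = nc_star (g v) * nc_star (f u)" for u v
    by (simp add: f_def g_def mult_single nc_star_single word_rev_add mult.commute)
  have "nc_star (sum f A * sum g B) = nc_star (sum g B) * nc_star (sum f A)" for A B
    unfolding sum_product nc_star_sum fg by (rule sum.swap)
  then show ?thesis
    using P Q by metis
qed

text \<open>The involution fixes the letters and conjugates the scalars, which determines it.\<close>

lemma nc_star_var: "nc_star (nc_var x) = nc_var x"
  by (simp add: nc_var_def nc_star_single word_rev_def)

lemma nc_star_const: "nc_star (nc_scale c 1) = nc_scale (cnj c) 1"
  by (simp add: nc_scale_conv_mult nc_star_single)

global_interpretation ncpoly: complex_star_algebra nc_scale nc_star
proof unfold_locales
  fix a b :: "'x ncpoly" and c d :: complex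
  show "nc_scale c (a + b) = nc_scale c a + nc_scale c b"
    by (simp add: nc_scale_conv_mult distrib_left)
  show "nc_scale (c + d) a = nc_scale c a + nc_scale d a"
    by (simp add: nc_scale_conv_mult single_add distrib_right)
  show "nc_scale c (nc_scale d a) = nc_scale (c * d) a"
    by (rule poly_mapping_eqI) simp
  show "nc_scale 1 a = a"
    by (rule poly_mapping_eqI) simp
  show "nc_scale c a * b = nc_scale c (a * b)"
    by (simp add: nc_scale_conv_mult mult.assoc)
  show "a * nc_scale c b = nc_scale c (a * b)"
    by (rule nc_scale_mult_right)
  show "nc_star (a + b) = nc_star a + nc_star b"
    by (rule nc_star_add)
  show "nc_star (nc_scale c a) = nc_scale (cnj c) (nc_star a)"
    by (rule poly_mapping_eqI) simp
  show "nc_star (a * b) = nc_star b * nc_star a"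
    by (rule nc_star_mult)
  show "nc_star (nc_star a) = a"
    by (rule poly_mapping_eqI) simp
qed


section \<open>Evaluation at matrices\<close>

definition word_eval :: "nat \<Rightarrow> ('x \<Rightarrow> complex mat) \<Rightarrow> 'x word \<Rightarrow> complex mat" where
  "word_eval k a w = foldr (\<lambda>x M. a x * M) (letters w) (1\<^sub>m k)"

text \<open>The linear combination of the word values is formed entrywise, as matrices of all
  sizes share one type, which therefore has no zero for \<^const>\<open>sum\<close>.\<close>

definition nc_eval :: "nat \<Rightarrow> ('x \<Rightarrow> complex mat) \<Rightarrow> 'x ncpoly \<Rightarrow> complex mat" where
  "nc_eval k a P = mat k k (\<lambda>ij.
     \<Sum>w\<in>Poly_Mapping.keys P. Poly_Mapping.lookup P w * word_eval k a w $$ ij)"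

definition selfadjoint_mats :: "nat \<Rightarrow> complex mat set" where
  "selfadjoint_mats k = {A \<in> carrier_mat k k. mat_adjoint A = A}"

definition matrix_identities :: "nat \<Rightarrow> 'x ncpoly set" where
  "matrix_identities k =
     {P. \<forall>a. (\<forall>x. a x \<in> selfadjoint_mats k) \<longrightarrow> nc_eval k a P = 0\<^sub>m k k}"

lemma mat_adjoint_square:
  assumes "A \<in> carrier_mat k k"
  shows "mat_adjoint A = mat k k (\<lambda>(i, j). cnj (A $$ (j, i)))"
  using assms by (intro eq_matI) (auto simp: mat_adjoint_def mat_of_rows_def)

lemma nc_eval_var:
  assumes "a x \<in> carrier_mat k k"
  shows "nc_eval k a (nc_var x) = a x"
  using assms by (intro eq_matI) (auto simp: nc_eval_def nc_var_def word_eval_def)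

lemma nc_eval_one: "nc_eval k a 1 = 1\<^sub>m k"
  by (intro eq_matI) (auto simp: nc_eval_def word_eval_def zero_word_def simp flip: single_one)

lemma word_eval_carrier:
  assumes "\<And>x. a x \<in> carrier_mat k k"
  shows "word_eval k a w \<in> carrier_mat k k"
proof -
  have "foldr (\<lambda>x M. a x * M) xs (1\<^sub>m k) \<in> carrier_mat k k" for xs
    by (induction xs) (use assms in \<open>auto intro: mult_carrier_mat\<close>)
  then show ?thesis by (simp add: word_eval_def)
qed

lemma word_eval_add:
  assumes "\<And>x. a x \<in> carrier_mat k k"
  shows "word_eval k a (u + v) = word_eval k a u * word_eval k a v"
proof -
  let ?E = "\<lambda>xs. foldr (\<lambda>x M. a x * M) xs (1\<^sub>m k)"
  have carrier: "?E xs \<in> carrier_mat k k" for xs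
    using word_eval_carrier[of a k "Word xs"] assms by (simp add: word_eval_def)
  have "?E (xs @ ys) = ?E xs * ?E ys" for xs ys
  proof (induction xs)
    case Nil
    then show ?case using carrier[of ys] by simp
  next
    case (Cons x xs)
    then show ?case
      using assoc_mult_mat[OF assms[of x] carrier[of xs] carrier[of ys]] by simp
  qed
  then show ?thesis by (simp add: word_eval_def plus_word_def)
qed

end

(* The ideal J_k is homogeneous, because self-adjoint matrices may be scaled by reals, and it has
   no element of degree < k, because a word u of length < k is detected by an entry of its value
   at the k x k matrices that describe a path whose edges are labelled by u.  Hence the truncation
   of tau to degrees <= 2d < k vanishes on J_k, and so do the homogeneous parts of the sum phi of
   the traces at all path matrices for words of length <= 2d.  To restore positivity, add
   r(m)^2 phi on degree 2m.  If r is sufficiently log-convex, the terms with different degrees i, j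
   are dominated by the diagonal ones (Schur test); so are the terms tau(P_i* P_j) with i > d or
   j > d, if r(i) r(j) is large there, whereas those with i, j <= d sum up to
   tau(P_low* P_low) >= 0, where P_low is the part of P of degree <= d.  As r can be as small
   as desired up to degree d, the normalised functionals converge to tau. *)

theory Submission
  imports Defs
begin

section \<open>Linear functionals given by their values on words\<close>

definition word_linear :: "('x word \<Rightarrow> complex) \<Rightarrow> 'x ncpoly \<Rightarrow> complex" where
  "word_linear t P = (\<Sum>w\<in>Poly_Mapping.keys P. Poly_Mapping.lookup P w * t w)"

lemma word_linear_superset:
  assumes "finite S" "Poly_Mapping.keys P \<subseteq> S"
  shows "word_linear t P = (\<Sum>w\<in>S. Poly_Mapping.lookup P w * t w)"
  unfolding word_linear_def using assms
  by (intro sum.mono_neutral_left) (auto simp: in_keys_iff)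

lemma word_linear_single [simp]: "word_linear t (Poly_Mapping.single w c) = c * t w"
  by (subst word_linear_superset[of "{w}"]) auto

lemma word_linear_add: "word_linear t (P + Q) = word_linear t P + word_linear t Q"
proof -
  let ?S = "Poly_Mapping.keys P \<union> Poly_Mapping.keys Q"
  have "word_linear t R = (\<Sum>w\<in>?S. Poly_Mapping.lookup R w * t w)" if "R \<in> {P, Q, P + Q}" for R
    using that keys_add[of P Q] by (intro word_linear_superset) auto
  then show ?thesis
    by (simp add: lookup_add distrib_right sum.distrib)
qed

lemma word_linear_scale: "word_linear t (nc_scale c P) = c * word_linear t P"
  by (subst word_linear_superset[of "Poly_Mapping.keys P"])
    (auto simp: in_keys_iff word_linear_def sum_distrib_left mult.assoc)

lemma word_linear_zero [simp]: "word_linear t 0 = 0"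
  by (simp add: word_linear_def)

lemma word_linear_sum: "word_linear t (sum f A) = (\<Sum>x\<in>A. word_linear t (f x))"
  by (induction A rule: infinite_finite_induct) (auto simp: word_linear_add)

lemma linear_word_linear: "Vector_Spaces.linear nc_scale (*) (word_linear t)"
  by unfold_locales
    (auto simp: word_linear_add word_linear_scale algebra_simps)

lemma word_linear_mult:
  "word_linear t (P * Q) = (\<Sum>u\<in>Poly_Mapping.keys P. \<Sum>v\<in>Poly_Mapping.keys Q.
     Poly_Mapping.lookup P u * Poly_Mapping.lookup Q v * t (u + v))"
proof -
  have "P * Q = (\<Sum>u\<in>Poly_Mapping.keys P. \<Sum>v\<in>Poly_Mapping.keys Q.
     Poly_Mapping.single (u + v) (Poly_Mapping.lookup P u * Poly_Mapping.lookup Q v))"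
    by (subst (1) ncpoly_sum_monomials[of P, symmetric],
        subst (1) ncpoly_sum_monomials[of Q, symmetric], unfold sum_product mult_single) simp
  then show ?thesis by (simp add: word_linear_sum)
qed

lemma keys_nc_star: "Poly_Mapping.keys (nc_star P) = word_rev ` Poly_Mapping.keys P"
  by (force simp: in_keys_iff image_iff intro: bexI[of _ "word_rev x" for x])

lemma word_linear_star_mult:
  "word_linear t (nc_star P * Q) = (\<Sum>u\<in>Poly_Mapping.keys P. \<Sum>v\<in>Poly_Mapping.keys Q.
     cnj (Poly_Mapping.lookup P u) * Poly_Mapping.lookup Q v * t (word_rev u + v))"
  unfolding word_linear_mult keys_nc_star
  by (subst sum.reindex) (auto intro: inj_on_subset[OF inj_word_rev])

lemma word_linear_commute:
  assumes "\<And>u v. t (u + v) = t (v + u)"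
  shows "word_linear t (P * Q) = word_linear t (Q * P)"
  unfolding word_linear_mult
  by (subst sum.swap) (simp add: assms mult.commute mult.left_commute)

text \<open>Allows a trace to be altered word by word without losing linearity.\<close>

lemma linear_functional_word_linear:
  assumes "Vector_Spaces.linear nc_scale (*) \<tau>"
  shows "\<tau> = word_linear (\<lambda>w. \<tau> (Poly_Mapping.single w 1))"
proof
  fix P
  interpret Vector_Spaces.linear nc_scale "(*)" \<tau> by fact
  have "\<tau> P = \<tau> (\<Sum>w\<in>Poly_Mapping.keys P. nc_scale (Poly_Mapping.lookup P w) (Poly_Mapping.single w 1))"
    by (simp add: nc_scale_conv_mult mult_single ncpoly_sum_monomials)
  also have "\<dots> = word_linear (\<lambda>w. \<tau> (Poly_Mapping.single w 1)) P"
    by (simp add: sum scale word_linear_def)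
  finally show "\<tau> P = \<dots>" .
qed

text \<open>Polarisation: positivity on \<open>1 + Q\<close> and on \<open>Q\<close> makes
  \<open>\<tau> Q + \<tau> (nc_star Q)\<close> real. The choice \<open>Q = P\<close> compares the
  imaginary parts, and the choice of \<open>\<i>\<close> times \<open>P\<close> the real
  parts.\<close>

lemma positive_trace_star:
  assumes "ncpoly.positive_trace \<tau>"
  shows "\<tau> (nc_star P) = cnj (\<tau> P)"
proof -
  interpret Vector_Spaces.linear nc_scale "(*)" \<tau>
    using assms by (simp add: ncpoly.positive_trace_def)
  have one: "nc_star 1 = 1" using nc_star_const[of 1] by simp
  have *: "Im (\<tau> (nc_star Q * Q)) = 0" for Q
    using assms by (auto simp: ncpoly.positive_trace_def less_eq_complex_def)
  have t1: "\<tau> 1 = 1" using assms by (simp add: ncpoly.positive_trace_def)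
  have ex: "nc_star (1 + Q) * (1 + Q) = 1 + Q + nc_star Q + nc_star Q * Q" for Q
    by (simp add: nc_star_add one algebra_simps)
  have "Im (\<tau> Q + \<tau> (nc_star Q)) = 0" for Q
    using *[of "1 + Q"] *[of Q] by (simp add: ex add t1)
  from this[of P] this[of "nc_scale \<i> P"] show ?thesis
    by (simp add: scale neg ncpoly.star_scale complex_eq_iff)
qed

lemma positive_trace_word_rev:
  assumes "ncpoly.positive_trace \<tau>"
  shows "\<tau> (Poly_Mapping.single (word_rev w) 1) = cnj (\<tau> (Poly_Mapping.single w 1))"
  using positive_trace_star[OF assms, of "Poly_Mapping.single w 1"] by (simp add: nc_star_single)

section \<open>A Schur test and the domination of off-diagonal terms\<close>

lemma geometric_fifth: "(\<Sum>m=1..n. (1/5::real)^m) \<le> 1/4"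
proof -
  have "(\<Sum>m=1..n. (1/5::real)^m) = 1/4 - (1/4) * (1/5)^n"
  proof (induction n)
    case (Suc n)
    have "(\<Sum>m=1..Suc n. (1/5::real)^m) = (\<Sum>m=1..n. (1/5)^m) + (1/5)^Suc n" by simp
    also have "\<dots> = 1/4 - (1/4) * (1/5)^Suc n" unfolding Suc.IH by simp
    finally show ?case .
  qed simp
  then show ?thesis by simp
qed

definition nat_dist :: "nat \<Rightarrow> nat \<Rightarrow> nat" where "nat_dist i j = (i - j) + (j - i)"

text \<open>Each side of the diagonal contributes at most 1/4. The ratio 1/5 is chosen for this
  bound, which is what the factor 2 in \<open>offdiagonal_schur\<close> can afford.\<close>

lemma offdiagonal_row_sum:
  assumes "i \<le> n"
  shows "(\<Sum>j\<in>{..n}-{i}. (1/5::real)^nat_dist i j) \<le> 1/2"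
proof -
  have eq: "{..n}-{i} = {..<i} \<union> {i<..n}" using assms by auto
  have "(\<Sum>j\<in>{..<i}. (1/5::real)^nat_dist i j) = (\<Sum>m=1..i. (1/5)^m)"
    by (rule sum.reindex_bij_witness[of _ "\<lambda>m. i - m" "\<lambda>j. i - j"]) (auto simp: nat_dist_def)
  moreover have "(\<Sum>j\<in>{i<..n}. (1/5::real)^nat_dist i j) = (\<Sum>m=1..n-i. (1/5)^m)"
    by (rule sum.reindex_bij_witness[of _ "\<lambda>m. i + m" "\<lambda>j. j - i"]) (auto simp: nat_dist_def)
  ultimately show ?thesis
    unfolding eq using geometric_fifth[of i] geometric_fifth[of "n-i"]
    by (subst sum.union_disjoint) auto
qed

text \<open>Each product is split by the inequality of the means, and the row sums of the symmetric
  kernel do the rest. The factor 2 leaves room for two families of off-diagonal terms in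
  \<open>dominated_form_nonneg\<close>, one from \<open>T\<close> and one from
  \<open>F\<close>.\<close>

lemma offdiagonal_schur:
  fixes x :: "nat \<Rightarrow> real"
  shows "(\<Sum>i\<le>n. \<Sum>j\<in>{..n}-{i}. 2 * (1/5)^nat_dist i j * (x i * x j)) \<le> (\<Sum>i\<le>n. (x i)\<^sup>2)"
proof -
  let ?K = "\<lambda>i j. (1/5::real)^nat_dist i j"
  let ?A = "\<Sum>i\<le>n. \<Sum>j\<in>{..n}-{i}. ?K i j * (x i)\<^sup>2"
  have sym: "?K i j = ?K j i" for i j by (simp add: nat_dist_def add.commute)
  have "(\<Sum>i\<le>n. \<Sum>j\<in>{..n}-{i}. 2 * ?K i j * (x i * x j))
      \<le> (\<Sum>i\<le>n. \<Sum>j\<in>{..n}-{i}. ?K i j * (x i)\<^sup>2 + ?K i j * (x j)\<^sup>2)"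
  proof (intro sum_mono)
    fix i j
    have "2 * (x i * x j) \<le> (x i)\<^sup>2 + (x j)\<^sup>2"
      using sum_squares_bound[of "x i" "x j"] by simp
    then have "?K i j * (2 * (x i * x j)) \<le> ?K i j * ((x i)\<^sup>2 + (x j)\<^sup>2)"
      by (intro mult_left_mono) auto
    then show "2 * ?K i j * (x i * x j) \<le> ?K i j * (x i)\<^sup>2 + ?K i j * (x j)\<^sup>2"
      by (simp add: algebra_simps)
  qed
  also have "\<dots> = ?A + (\<Sum>i\<le>n. \<Sum>j\<in>{..n}-{i}. ?K i j * (x j)\<^sup>2)"
    by (simp add: sum.distrib)
  also have "(\<Sum>i\<le>n. \<Sum>j\<in>{..n}-{i}. ?K i j * (x j)\<^sup>2) = ?A"
  proof -
    have "(\<Sum>i\<le>n. \<Sum>j\<in>{..n}-{i}. ?K i j * (x j)\<^sup>2)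
        = (\<Sum>(i,j)\<in>Sigma {..n} (\<lambda>i. {..n}-{i}). ?K i j * (x j)\<^sup>2)"
      by (simp add: sum.Sigma)
    also have "\<dots> = (\<Sum>(i,j)\<in>Sigma {..n} (\<lambda>i. {..n}-{i}). ?K i j * (x i)\<^sup>2)"
      by (rule sum.reindex_bij_witness[of _ prod.swap prod.swap]) (auto simp: sym)
    also have "\<dots> = ?A" by (simp add: sum.Sigma)
    finally show ?thesis .
  qed
  also have "?A + ?A = (\<Sum>i\<le>n. (x i)\<^sup>2 * (2 * (\<Sum>j\<in>{..n}-{i}. ?K i j)))"
    by (simp add: sum_distrib_right sum_distrib_left mult_ac flip: sum.distrib)
  also have "\<dots> \<le> (\<Sum>i\<le>n. (x i)\<^sup>2 * 1)"
    using offdiagonal_row_sum by (intro sum_mono mult_left_mono) (auto simp: field_simps)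
  finally show ?thesis by simp
qed

text \<open>The triangle \<open>i + j \<le> 2 * d\<close> is cut into the square
  \<open>i, j \<le> d\<close>, where \<open>T\<close> is nonnegative as a whole, and a remainder
  \<open>V\<close>. With \<open>x i = r i * N i\<close>, both \<open>V\<close> and the off-diagonal
  part of the weighted \<open>F\<close> are bounded by the kernel times \<open>x i * x j\<close>,
  while the diagonal of the weighted \<open>F\<close> supplies the squares of the \<open>x i\<close>
  that absorb them.\<close>

lemma dominated_form_nonneg:
  fixes T F :: "nat \<Rightarrow> nat \<Rightarrow> complex" and N r :: "nat \<Rightarrow> real"
  assumes "2 * d \<le> n"
    and N: "\<And>i. 0 \<le> N i"
    and F_diag: "\<And>i. F i i = of_real ((N i)\<^sup>2)"
    and F_le: "\<And>i j. cmod (F i j) \<le> N i * N j"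
    and T_low: "0 \<le> Re (\<Sum>i\<le>d. \<Sum>j\<le>d. T i j)"
    and T_le: "\<And>i j. i + j \<le> 2 * d \<Longrightarrow> cmod (T i j) \<le> C * (N i * N j)"
    and r_even: "\<And>i j. even (i + j) \<Longrightarrow> (r ((i + j) div 2))\<^sup>2 \<le> (1/5)^nat_dist i j * (r i * r j)"
    and r_large: "\<And>i j. i + j \<le> 2 * d \<Longrightarrow> d < i \<or> d < j \<Longrightarrow> C \<le> (1/5)^nat_dist i j * (r i * r j)"
    and r: "\<And>i. 0 \<le> r i"
  shows "0 \<le> Re (\<Sum>i\<le>n. \<Sum>j\<le>n. (if i + j \<le> 2 * d then T i j else 0)
            + (if even (i + j) then of_real ((r ((i + j) div 2))\<^sup>2) * F i j else 0))"
proof -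
  define x where "x i = r i * N i" for i
  define G where "G i j = (if even (i + j) then of_real ((r ((i + j) div 2))\<^sup>2) * F i j else 0)" for i j
  define U where "U i j = (if i \<le> d \<and> j \<le> d then T i j else 0)" for i j
  define V where "V i j = (if i + j \<le> 2 * d \<and> (d < i \<or> d < j) then T i j else 0)" for i j
  let ?K = "\<lambda>i j. (1/5::real)^nat_dist i j"
  have split: "(if i + j \<le> 2 * d then T i j else 0) = U i j + V i j" for i j
    by (auto simp: U_def V_def)
  have xx: "0 \<le> ?K i j * (x i * x j)" for i j by (simp add: x_def r N)
  have V_le: "cmod (V i j) \<le> ?K i j * (x i * x j)" for i j
  proof (cases "i + j \<le> 2 * d \<and> (d < i \<or> d < j)")
    case True
    then have "cmod (V i j) \<le> C * (N i * N j)" by (simp add: V_def T_le)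
    also have "\<dots> \<le> (?K i j * (r i * r j)) * (N i * N j)"
      using True by (intro mult_right_mono r_large) (auto simp: N)
    finally show ?thesis by (simp add: x_def mult_ac)
  qed (use xx in \<open>auto simp: V_def\<close>)
  \<comment> \<open>\<open>i + i \<le> 2 * d\<close> forces \<open>i \<le> d\<close>, so the
    remainder takes nothing from the diagonal.\<close>
  have V_diag: "V i i = 0" for i by (auto simp: V_def)
  have G_le: "cmod (G i j) \<le> ?K i j * (x i * x j)" for i j
  proof (cases "even (i + j)")
    case True
    then have "cmod (G i j) = (r ((i + j) div 2))\<^sup>2 * cmod (F i j)" by (simp add: G_def norm_mult norm_power)
    also have "\<dots> \<le> (?K i j * (r i * r j)) * (N i * N j)"
      using True by (intro mult_mono r_even F_le) (auto simp: N r)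
    finally show ?thesis by (simp add: x_def mult_ac)
  qed (use xx in \<open>auto simp: G_def\<close>)
  have G_diag: "G i i = of_real ((x i)\<^sup>2)" for i
    by (simp add: G_def F_diag x_def power_mult_distrib)
  have row: "(\<Sum>j\<le>n. V i j + G i j) = (\<Sum>j\<in>{..n}-{i}. V i j + G i j) + of_real ((x i)\<^sup>2)" if "i \<le> n" for i
    using that by (subst sum.remove[of _ i]) (auto simp: V_diag G_diag)
  have off: "- (\<Sum>j\<in>{..n}-{i}. 2 * ?K i j * (x i * x j)) \<le> Re (\<Sum>j\<in>{..n}-{i}. V i j + G i j)" for i
  proof -
    have "cmod (\<Sum>j\<in>{..n}-{i}. V i j + G i j) \<le> (\<Sum>j\<in>{..n}-{i}. 2 * ?K i j * (x i * x j))"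
    proof (rule sum_norm_le)
      fix j
      show "cmod (V i j + G i j) \<le> 2 * ?K i j * (x i * x j)"
        using norm_triangle_ineq[of "V i j" "G i j"] V_le[of i j] G_le[of i j] by linarith
    qed
    then show ?thesis using abs_Re_le_cmod[of "\<Sum>j\<in>{..n}-{i}. V i j + G i j"] by linarith
  qed
  have U_sum: "(\<Sum>i\<le>n. \<Sum>j\<le>n. U i j) = (\<Sum>i\<le>d. \<Sum>j\<le>d. T i j)"
  proof -
    have "(\<Sum>j\<le>n. U i j) = (if i \<le> d then \<Sum>j\<le>d. T i j else 0)" for i
      using assms(1) unfolding U_def
      by (auto simp: sum.If_cases simp flip: sum.inter_filter intro!: sum.mono_neutral_cong_right)
    then show ?thesis using assms(1)
      by (auto intro!: sum.mono_neutral_cong_right split: if_splits)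
  qed
  have "(\<Sum>i\<le>n. \<Sum>j\<le>n. (if i + j \<le> 2 * d then T i j else 0) + G i j)
      = (\<Sum>i\<le>n. \<Sum>j\<le>n. U i j) + (\<Sum>i\<le>n. \<Sum>j\<le>n. V i j + G i j)"
    by (simp add: split sum.distrib)
  moreover have "0 \<le> Re (\<Sum>i\<le>n. \<Sum>j\<le>n. V i j + G i j)"
  proof -
    have "0 \<le> (\<Sum>i\<le>n. (x i)\<^sup>2) - (\<Sum>i\<le>n. \<Sum>j\<in>{..n}-{i}. 2 * ?K i j * (x i * x j))"
      using offdiagonal_schur[where n = n and x = x] by simp
    also have "\<dots> = (\<Sum>i\<le>n. (x i)\<^sup>2 - (\<Sum>j\<in>{..n}-{i}. 2 * ?K i j * (x i * x j)))"
      by (simp add: sum_subtractf)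
    also have "\<dots> \<le> (\<Sum>i\<le>n. Re (\<Sum>j\<le>n. V i j + G i j))"
    proof (rule sum_mono)
      fix i assume "i \<in> {..n}"
      then have "Re (\<Sum>j\<le>n. V i j + G i j) = Re (\<Sum>j\<in>{..n}-{i}. V i j + G i j) + (x i)\<^sup>2"
        by (simp only: row atMost_iff plus_complex.sel Re_complex_of_real)
      with off[of i] show "(x i)\<^sup>2 - (\<Sum>j\<in>{..n}-{i}. 2 * ?K i j * (x i * x j)) \<le> Re (\<Sum>j\<le>n. V i j + G i j)"
        by linarith
    qed
    finally show ?thesis by simp
  qed
  ultimately show ?thesis using T_low U_sum unfolding G_def by simp
qed

lemma weight_exists:
  fixes C s :: real
  assumes s: "0 < s" and C: "0 \<le> C"
  shows "\<exists>r :: nat \<Rightarrow> real. (\<forall>m. 0 < r m) \<and> (\<forall>m\<le>d. r m = s * 5^m\<^sup>2) \<and>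
    (\<forall>i j. even (i + j) \<longrightarrow> (r ((i + j) div 2))\<^sup>2 \<le> (1/5)^nat_dist i j * (r i * r j)) \<and>
    (\<forall>i j. d < i \<or> d < j \<longrightarrow> C \<le> (1/5)^nat_dist i j * (r i * r j))"
proof -
  \<comment> \<open>The Gaussian factor makes \<open>r\<close> log-convex.  As the subtraction is truncated, the power of \<open>b\<close>
    leaves \<open>r\<close> small up to \<open>d\<close>, and makes \<open>r i * r j\<close> large as soon as \<open>d < i\<close> or \<open>d < j\<close>.\<close>
  define b where "b = 1 + C / s\<^sup>2"
  define r where "r m = s * 5^m\<^sup>2 * b^(m-d)" for m :: nat
  have b: "1 \<le> b" using C by (simp add: b_def)
  have nd: "nat_dist i j \<le> i\<^sup>2 + j\<^sup>2" for i j
  proof -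
    have "i \<le> i\<^sup>2" "j \<le> j\<^sup>2" by (simp_all add: power2_eq_square)
    then show ?thesis unfolding nat_dist_def by linarith
  qed
  have large: "C \<le> (1/5)^nat_dist i j * (r i * r j)" if "d < i \<or> d < j" for i j
  proof -
    \<comment> \<open>By the choice of \<open>b\<close>, the right-hand side is
      \<open>s\<^sup>2 + C\<close>. At least one factor \<open>b\<close> occurs in
      \<open>r i * r j\<close>, and by \<open>nd\<close> the Gaussian factors outweigh the decay of
      the kernel.\<close>
    have "C \<le> s\<^sup>2 * b" using s by (simp add: b_def field_simps)
    also have "\<dots> \<le> s\<^sup>2 * (b^((i-d)+(j-d)) * (5^(i\<^sup>2+j\<^sup>2) * (1/5)^nat_dist i j))"
    proof (intro mult_left_mono)
      have "b^1 \<le> b^((i-d)+(j-d))" using that b by (intro power_increasing) auto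
      moreover have "1 \<le> 5^(i\<^sup>2+j\<^sup>2) * (1/5::real)^nat_dist i j"
        using power_increasing[OF nd, of "5::real" i j] by (simp add: power_one_over field_simps)
      ultimately have "b * 1 \<le> b^((i-d)+(j-d)) * (5^(i\<^sup>2+j\<^sup>2) * (1/5)^nat_dist i j)"
        using b by (intro mult_mono) auto
      then show "b \<le> b^((i-d)+(j-d)) * (5^(i\<^sup>2+j\<^sup>2) * (1/5)^nat_dist i j)" by simp
    qed simp
    also have "\<dots> = (1/5)^nat_dist i j * (r i * r j)"
      by (simp add: r_def power_add power2_eq_square mult_ac)
    finally show ?thesis .
  qed
  have conv: "(r ((i + j) div 2))\<^sup>2 \<le> (1/5)^nat_dist i j * (r i * r j)" if e: "even (i + j)" for i j
  proof -
    obtain m where m: "i + j = 2 * m" using e by blast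
    \<comment> \<open>Truncated subtraction of \<open>d\<close> is convex, so the powers of
      \<open>b\<close> respect the midpoint inequality.\<close>
    have md: "2 * (m - d) \<le> (i - d) + (j - d)" using m by linarith
    \<comment> \<open>If \<open>i\<close> and \<open>j\<close> are \<open>m - e\<close> and
      \<open>m + e\<close> in some order, their squares exceed twice the square of \<open>m\<close>
      by \<open>2 * e * e\<close>. This is at least \<open>2 * e\<close>, the distance of
      \<open>i\<close> and \<open>j\<close>, and yields the kernel factor.\<close>
    have sq: "2 * m\<^sup>2 + nat_dist i j \<le> i\<^sup>2 + j\<^sup>2"
    proof -
      have main: "2 * m\<^sup>2 + 2 * e \<le> i\<^sup>2 + j\<^sup>2" if "i + e = m" "j = m + e" for i j e :: nat
      proof -
        have "e \<le> e * e" by simp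
        moreover have "m * m = i * i + 2 * (i * e) + e * e" using that(1)[symmetric] by (simp add: algebra_simps)
        moreover have "m * e = i * e + e * e" using that(1)[symmetric] by (simp add: algebra_simps)
        ultimately show ?thesis using that by (simp add: power2_eq_square algebra_simps)
      qed
      show ?thesis
      proof (cases "i \<le> j")
        case True
        have "nat_dist i j = 2 * (m - i)" using m True by (simp add: nat_dist_def)
        moreover have "i + (m - i) = m" "j = m + (m - i)" using m True by auto
        ultimately show ?thesis using main[of i "m - i" j] by linarith
      next
        case False
        have "nat_dist i j = 2 * (m - j)" using m False by (simp add: nat_dist_def)
        moreover have "j + (m - j) = m" "i = m + (m - j)" using m False by auto
        ultimately show ?thesis using main[of j "m - j" i] by linarith
      qed
    qed
    have "(r m)\<^sup>2 = s\<^sup>2 * (5^(2 * m\<^sup>2) * b^(2 * (m-d)))"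
      by (simp add: r_def power_mult_distrib mult_ac flip: power_mult)
    also have "\<dots> \<le> s\<^sup>2 * ((5^(i\<^sup>2+j\<^sup>2) * (1/5)^nat_dist i j) * b^((i-d)+(j-d)))"
    proof (intro mult_left_mono mult_mono)
      show "5 ^ (2 * m\<^sup>2) \<le> 5^(i\<^sup>2+j\<^sup>2) * (1/5::real)^nat_dist i j"
        using power_increasing[OF sq, of "5::real"] by (simp add: power_one_over power_add field_simps)
      show "b^(2 * (m-d)) \<le> b^((i-d)+(j-d))" using md b by (intro power_increasing) auto
    qed (use b in auto)
    also have "\<dots> = (1/5)^nat_dist i j * (r i * r j)"
      by (simp add: r_def power_add power2_eq_square mult_ac)
    finally show ?thesis using m by simp
  qed
  show ?thesis
    using conv large s b by (intro exI[of _ r]) (auto simp: r_def)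
qed

section \<open>Word length and evaluation at self-adjoint matrices\<close>

abbreviation wlen :: "'x word \<Rightarrow> nat" where "wlen w \<equiv> length (letters w)"

lemma wlen_word_rev [simp]: "wlen (word_rev w) = wlen w"
  by (simp add: word_rev_def)

lemma wlen_add [simp]: "wlen (u + v) = wlen u + wlen v"
  by (simp add: plus_word_def)

lemma wlen_zero [simp]: "wlen 0 = 0"
  by (simp add: zero_word_def)

lemma finite_words_le: "finite {w :: 'x::finite word. wlen w \<le> n}"
proof (rule finite_subset)
  show "{w :: 'x word. wlen w \<le> n} \<subseteq> Word ` {xs. set xs \<subseteq> UNIV \<and> length xs \<le> n}"
  proof
    fix w :: "'x word" assume "w \<in> {w. wlen w \<le> n}"
    then show "w \<in> Word ` {xs. set xs \<subseteq> UNIV \<and> length xs \<le> n}" by (cases w) auto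
  qed
  show "finite (Word ` {xs :: 'x list. set xs \<subseteq> UNIV \<and> length xs \<le> n})"
    by (intro finite_imageI finite_lists_length_le) simp
qed

lemma word_eval_zero: "word_eval k a 0 = 1\<^sub>m k"
  by (simp add: word_eval_def zero_word_def)

lemma word_eval_Cons: "word_eval k a (Word (x # xs)) = a x * word_eval k a (Word xs)"
  by (simp add: word_eval_def)

lemma index_mult_square:
  assumes "A \<in> carrier_mat k k" "B \<in> carrier_mat k k" "i < k" "j < k"
  shows "(A * B) $$ (i, j) = (\<Sum>l<k. A $$ (i, l) * B $$ (l, j))"
  using assms by (simp add: scalar_prod_def atLeast0LessThan)

lemma selfadjoint_mats_index:
  assumes "A \<in> selfadjoint_mats k" "i < k" "j < k"
  shows "A $$ (i, j) = cnj (A $$ (j, i))"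
proof -
  have "A = mat k k (\<lambda>(i, j). cnj (A $$ (j, i)))"
    using assms mat_adjoint_square[of A k] by (simp add: selfadjoint_mats_def)
  then show ?thesis using assms(2,3) by (metis (no_types, lifting) case_prod_conv index_mat(1))
qed

text \<open>Since the letters have self-adjoint values, reversing a product takes its adjoint. This
  is what later turns traces of \<open>word_rev v + w\<close> into inner products.\<close>

lemma word_eval_word_rev:
  assumes a: "\<And>x. a x \<in> selfadjoint_mats k" and "i < k" "j < k"
  shows "word_eval k a (word_rev w) $$ (i, j) = cnj (word_eval k a w $$ (j, i))"
proof -
  have c: "a x \<in> carrier_mat k k" for x using a by (simp add: selfadjoint_mats_def)
  have "word_eval k a (word_rev (Word xs)) $$ (i, j) = cnj (word_eval k a (Word xs) $$ (j, i))"
    if "i < k" "j < k" for xs i j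
    using that
  proof (induction xs arbitrary: i j)
    case Nil
    then show ?case by (auto simp: word_eval_def word_rev_def)
  next
    case (Cons x xs)
    have x: "word_eval k a (Word [x]) = a x"
      using c[of x] by (simp add: word_eval_def)
    have "word_rev (Word (x # xs)) = word_rev (Word xs) + Word [x]"
      by (simp add: word_rev_def plus_word_def)
    then have "word_eval k a (word_rev (Word (x # xs))) $$ (i, j)
        = (\<Sum>l<k. word_eval k a (word_rev (Word xs)) $$ (i, l) * a x $$ (l, j))"
      using Cons.prems c by (simp add: word_eval_add x index_mult_square word_eval_carrier)
    also have "\<dots> = (\<Sum>l<k. cnj (word_eval k a (Word xs) $$ (l, i)) * cnj (a x $$ (j, l)))"
    proof (intro sum.cong refl)
      fix l assume "l \<in> {..<k}"
      then have "a x $$ (l, j) = cnj (a x $$ (j, l))"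
        using Cons.prems by (intro selfadjoint_mats_index[OF a]) auto
      then show "word_eval k a (word_rev (Word xs)) $$ (i, l) * a x $$ (l, j)
          = cnj (word_eval k a (Word xs) $$ (l, i)) * cnj (a x $$ (j, l))"
        using Cons.prems \<open>l \<in> {..<k}\<close> by (simp only: Cons.IH lessThan_iff)
    qed
    also have "\<dots> = cnj (word_eval k a (Word (x # xs)) $$ (j, i))"
      using Cons.prems c word_eval_carrier[of a k, OF c]
      by (simp add: word_eval_Cons index_mult_square[of _ k] mult.commute)
    finally show ?case .
  qed
  from this[OF assms(2,3), of "letters w"] show ?thesis by simp
qed

lemma word_eval_smult:
  assumes c: "\<And>x. a x \<in> carrier_mat k k"
  shows "word_eval k (\<lambda>x. z \<cdot>\<^sub>m a x) w = z ^ wlen w \<cdot>\<^sub>m word_eval k a w"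
proof -
  have "word_eval k (\<lambda>x. z \<cdot>\<^sub>m a x) (Word xs) = z ^ length xs \<cdot>\<^sub>m word_eval k a (Word xs)" for xs
  proof (induction xs)
    case Nil
    then show ?case by (auto simp: word_eval_def)
  next
    case (Cons x xs)
    have "word_eval k a (Word xs) \<in> carrier_mat k k" using c by (rule word_eval_carrier)
    then show ?case using c[of x]
      by (intro eq_matI)
        (auto simp: word_eval_Cons Cons.IH mult_smult_distrib mult_smult_assoc_mat[of _ k k _ k] mult_ac)
  qed
  from this[of "letters w"] show ?thesis by simp
qed

lemma smult_selfadjoint_mats:
  assumes "A \<in> selfadjoint_mats k"
  shows "complex_of_real t \<cdot>\<^sub>m A \<in> selfadjoint_mats k"
proof -
  have A: "A \<in> carrier_mat k k" using assms by (simp add: selfadjoint_mats_def)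
  then have "mat_adjoint (complex_of_real t \<cdot>\<^sub>m A) = complex_of_real t \<cdot>\<^sub>m A"
    by (subst mat_adjoint_square[of _ k])
      (auto intro!: eq_matI simp: selfadjoint_mats_index[OF assms, symmetric])
  then show ?thesis using A by (simp add: selfadjoint_mats_def)
qed

text \<open>Replacing \<open>a\<close> by \<open>t a\<close> turns an entry of the value of \<open>P\<close> into a polynomial in \<open>t\<close>
  that vanishes on the reals, so the homogeneous components of an identity are identities.\<close>

lemma matrix_identities_homogeneous:
  assumes P: "P \<in> matrix_identities k" and a: "\<And>x. a x \<in> selfadjoint_mats k" and ij: "i < k" "j < k"
  shows "(\<Sum>w | w \<in> Poly_Mapping.keys P \<and> wlen w = m. Poly_Mapping.lookup P w * word_eval k a w $$ (i, j)) = 0"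
proof -
  let ?f = "\<lambda>w. Poly_Mapping.lookup P w * word_eval k a w $$ (i, j)"
  define p where "p = (\<Sum>w\<in>Poly_Mapping.keys P. monom (?f w) (wlen w))"
  have c: "a x \<in> carrier_mat k k" for x using a by (simp add: selfadjoint_mats_def)
  have "poly p (of_real t) = 0" for t
  proof -
    have "nc_eval k (\<lambda>x. of_real t \<cdot>\<^sub>m a x) P = 0\<^sub>m k k"
      using P smult_selfadjoint_mats[OF a] by (simp add: matrix_identities_def)
    then have "nc_eval k (\<lambda>x. of_real t \<cdot>\<^sub>m a x) P $$ (i, j) = 0"
      using ij by simp
    moreover have "word_eval k (\<lambda>x. of_real t \<cdot>\<^sub>m a x) w $$ (i, j) = of_real t ^ wlen w * word_eval k a w $$ (i, j)" for w
      using ij word_eval_carrier[of a k w, OF c] by (simp add: word_eval_smult[OF c])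
    ultimately show ?thesis
      using ij by (simp add: nc_eval_def p_def poly_sum poly_monom mult_ac)
  qed
  then have "range complex_of_real \<subseteq> {z. poly p z = 0}" by auto
  then have "infinite {z. poly p z = 0}"
    using range_inj_infinite finite_subset by (metis inj_of_real infinite_UNIV_char_0 finite_imageD)
  then have "p = 0" using poly_roots_finite by blast
  then have "coeff p m = 0" by simp
  then show ?thesis
    unfolding p_def coeff_sum coeff_monom by (subst (asm) sum.inter_filter[symmetric]) (auto)
qed

section \<open>Path matrices and the absence of identities of low degree\<close>

text \<open>The adjacency matrix of the edges labelled \<open>x\<close> in the path on the vertices
  \<open>0\<close>, ..., \<open>wlen u\<close> whose successive edges carry the letters of
  \<open>u\<close>. Both directions of an edge are entered to make it self-adjoint. The path fits if
  \<open>wlen u < k\<close>, and any further vertices are isolated.\<close>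

definition path_mat :: "nat \<Rightarrow> 'x word \<Rightarrow> 'x \<Rightarrow> complex mat" where
  "path_mat k u x = mat k k (\<lambda>(p, q).
     if q = Suc p \<and> p < wlen u \<and> letters u ! p = x \<or> p = Suc q \<and> q < wlen u \<and> letters u ! q = x
     then 1 else 0)"

lemma path_mat_selfadjoint: "path_mat k u x \<in> selfadjoint_mats k"
  unfolding selfadjoint_mats_def
  by (auto simp: mat_adjoint_square[of _ k] path_mat_def intro!: eq_matI)

lemma path_mat_carrier: "path_mat k u x \<in> carrier_mat k k"
  by (simp add: path_mat_def)

text \<open>Each letter moves by at most one vertex along the path, so the last vertex is reached from
  \<open>p\<close> in \<open>wlen u - p\<close> steps only by reading the letters of \<open>u\<close> from \<open>p\<close> on.\<close>

lemma word_eval_path_mat: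
  assumes k: "wlen u < k" and "p + length v \<le> wlen u"
  shows "word_eval k (path_mat k u) (Word v) $$ (p, wlen u) = (if v = drop p (letters u) then 1 else 0)"
  using assms(2)
proof (induction v arbitrary: p)
  case Nil
  then show ?case using k by (auto simp: word_eval_def)
next
  case (Cons x v)
  let ?n = "wlen u" and ?E = "word_eval k (path_mat k u) (Word v)"
  have p: "p < ?n" using Cons.prems by simp
  have "word_eval k (path_mat k u) (Word (x # v)) $$ (p, ?n)
      = (\<Sum>q<k. path_mat k u x $$ (p, q) * ?E $$ (q, ?n))"
    using p k by (simp add: word_eval_Cons index_mult_square path_mat_carrier word_eval_carrier)
  also have "\<dots> = (\<Sum>q\<in>{Suc p}. path_mat k u x $$ (p, q) * ?E $$ (q, ?n))"
  proof (rule sum.mono_neutral_right)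
    show "\<forall>q\<in>{..<k} - {Suc p}. path_mat k u x $$ (p, q) * ?E $$ (q, ?n) = 0"
    proof
      fix q assume q: "q \<in> {..<k} - {Suc p}"
      show "path_mat k u x $$ (p, q) * ?E $$ (q, ?n) = 0"
      proof (cases "p = Suc q")
        case True
        \<comment> \<open>After a step back, \<open>v\<close> is at least two letters shorter than
          \<open>drop q (letters u)\<close>.\<close>
        then have "v \<noteq> drop q (letters u)" using Cons.prems by auto
        then show ?thesis using Cons.IH[of q] True Cons.prems by simp
      qed (use q p k in \<open>auto simp: path_mat_def\<close>)
    qed
  qed (use p k in auto)
  also have "\<dots> = (if x # v = drop p (letters u) then 1 else 0)"
  proof -
    have "path_mat k u x $$ (p, Suc p) = (if letters u ! p = x then 1 else 0)"
      using p k by (simp add: path_mat_def)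
    moreover have "?E $$ (Suc p, ?n) = (if v = drop (Suc p) (letters u) then 1 else 0)"
      using Cons.IH[of "Suc p"] Cons.prems by simp
    moreover have "x # v = drop p (letters u) \<longleftrightarrow> letters u ! p = x \<and> v = drop (Suc p) (letters u)"
      by (auto simp flip: Cons_nth_drop_Suc[OF p])
    ultimately show ?thesis by simp
  qed
  finally show ?case .
qed

lemma word_eval_path_mat_ends:
  assumes "wlen u < k" "wlen v = wlen u"
  shows "word_eval k (path_mat k u) v $$ (0, wlen u) = (if v = u then 1 else 0)"
  using word_eval_path_mat[OF assms(1), of 0 "letters v"] assms(2)
  by (auto simp: word.expand)

text \<open>Among the words as long as \<open>u\<close>, only \<open>u\<close> itself leads from one
  end of its path to the other. The corresponding entry of the homogeneous component of
  \<open>P\<close> is therefore the coefficient of \<open>u\<close>.\<close>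

lemma matrix_identities_lookup:
  assumes "P \<in> matrix_identities k" "wlen u < k"
  shows "Poly_Mapping.lookup P u = 0"
proof -
  have "0 = (\<Sum>w | w \<in> Poly_Mapping.keys P \<and> wlen w = wlen u.
      Poly_Mapping.lookup P w * word_eval k (path_mat k u) w $$ (0, wlen u))"
    using assms by (intro matrix_identities_homogeneous[symmetric] path_mat_selfadjoint) auto
  also have "\<dots> = (\<Sum>w | w \<in> Poly_Mapping.keys P \<and> wlen w = wlen u.
      if w = u then Poly_Mapping.lookup P w else 0)"
    using assms(2) by (intro sum.cong) (auto simp: word_eval_path_mat_ends)
  also have "\<dots> = Poly_Mapping.lookup P u"
    by (auto simp: in_keys_iff)
  finally show ?thesis by simp
qed

section \<open>A trace that detects all words up to a given length\<close>

text \<open>The unnormalised trace of the direct sum of the representations by path matrices, so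
  that a single functional sees every word of length at most \<open>n\<close>.\<close>

definition path_trace :: "nat \<Rightarrow> nat \<Rightarrow> 'x word \<Rightarrow> complex" where
  "path_trace k n w = (\<Sum>u | wlen u \<le> n. \<Sum>p<k. word_eval k (path_mat k u) w $$ (p, p))"

lemma path_trace_add:
  "path_trace k n (v + w) = (\<Sum>u | wlen u \<le> n. \<Sum>p<k. \<Sum>q<k.
     word_eval k (path_mat k u) v $$ (p, q) * word_eval k (path_mat k u) w $$ (q, p))"
  unfolding path_trace_def
  by (intro sum.cong refl)
    (simp add: word_eval_add path_mat_carrier index_mult_square word_eval_carrier)

lemma path_trace_commute: "path_trace k n (v + w) = path_trace k n (w + v)"
  unfolding path_trace_add
  by (rule sum.cong[OF refl], subst sum.swap) (simp add: mult.commute)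

lemma path_trace_word_rev: "path_trace k n (word_rev w) = cnj (path_trace k n w)"
  unfolding path_trace_def cnj_sum
  by (intro sum.cong refl) (simp add: word_eval_word_rev path_mat_selfadjoint)

text \<open>A sum of Hilbert-Schmidt inner products: both factors carry the same entry
  \<open>(q, p)\<close>, so the form is a Gram form.\<close>

lemma path_trace_rev_add:
  "path_trace k n (word_rev v + w) = (\<Sum>u | wlen u \<le> n. \<Sum>p<k. \<Sum>q<k.
     cnj (word_eval k (path_mat k u) v $$ (q, p)) * word_eval k (path_mat k u) w $$ (q, p))"
  unfolding path_trace_add
  by (intro sum.cong refl) (simp add: word_eval_word_rev path_mat_selfadjoint)

lemma path_trace_zero:
  "path_trace k n (0 :: 'x word) = of_nat (card {u :: 'x word. wlen u \<le> n} * k)"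
  by (simp add: path_trace_def word_eval_zero)

text \<open>Vanishing in each degree separately is required because the degrees will be weighted
  differently.\<close>

lemma path_trace_homogeneous:
  assumes "P \<in> matrix_identities k"
  shows "(\<Sum>w | w \<in> Poly_Mapping.keys P \<and> wlen w = m. Poly_Mapping.lookup P w * path_trace k n w) = 0"
proof -
  let ?W = "{w. w \<in> Poly_Mapping.keys P \<and> wlen w = m}"
  let ?f = "\<lambda>u p w. Poly_Mapping.lookup P w * word_eval k (path_mat k u) w $$ (p, p)"
  have "(\<Sum>w\<in>?W. Poly_Mapping.lookup P w * path_trace k n w) = (\<Sum>w\<in>?W. \<Sum>u | wlen u \<le> n. \<Sum>p<k. ?f u p w)"
    by (simp add: path_trace_def sum_distrib_left)
  also have "\<dots> = (\<Sum>u | wlen u \<le> n. \<Sum>w\<in>?W. \<Sum>p<k. ?f u p w)" by (rule sum.swap)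
  also have "\<dots> = (\<Sum>u | wlen u \<le> n. \<Sum>p<k. \<Sum>w\<in>?W. ?f u p w)"
    by (intro sum.cong refl) (rule sum.swap)
  also have "\<dots> = 0"
    by (intro sum.neutral ballI matrix_identities_homogeneous[OF assms] path_mat_selfadjoint) auto
  finally show ?thesis .
qed

section \<open>Decomposition of sesquilinear forms by degree\<close>

text \<open>Turns a form on words into a matrix indexed by degrees, as
  \<open>dominated_form_nonneg\<close> requires.\<close>

lemma sum_group_length:
  fixes f :: "'x word \<Rightarrow> 'x word \<Rightarrow> complex"
  assumes K: "finite K" and n: "\<And>w. w \<in> K \<Longrightarrow> wlen w \<le> n"
  shows "(\<Sum>v\<in>K. \<Sum>w\<in>K. f v w)
    = (\<Sum>i\<le>n. \<Sum>j\<le>n. \<Sum>v | v \<in> K \<and> wlen v = i. \<Sum>w | w \<in> K \<and> wlen w = j. f v w)"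
proof -
  have g: "(\<Sum>i\<le>n. sum h {v. v \<in> K \<and> wlen v = i}) = sum h K" for h :: "'x word \<Rightarrow> complex"
    using sum.group[of K "{..n}" wlen h] K n by auto
  have "(\<Sum>v\<in>K. \<Sum>w\<in>K. f v w) = (\<Sum>i\<le>n. \<Sum>v | v \<in> K \<and> wlen v = i. \<Sum>w\<in>K. f v w)"
    by (rule g[symmetric])
  also have "\<dots> = (\<Sum>i\<le>n. \<Sum>v | v \<in> K \<and> wlen v = i. \<Sum>j\<le>n. \<Sum>w | w \<in> K \<and> wlen w = j. f v w)"
    by (simp only: g)
  also have "\<dots> = (\<Sum>i\<le>n. \<Sum>j\<le>n. \<Sum>v | v \<in> K \<and> wlen v = i. \<Sum>w | w \<in> K \<and> wlen w = j. f v w)"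
    by (intro sum.cong refl) (rule sum.swap)
  finally show ?thesis .
qed

text \<open>The witness \<open>N i\<close> is the Hilbert-Schmidt norm of the degree \<open>i\<close> component evaluated at all
  path matrices; the coefficient of \<open>u\<close> is an entry of the value at the path of \<open>u\<close>.\<close>

lemma path_trace_gram:
  fixes c :: "'x::finite word \<Rightarrow> complex"
  assumes K: "finite K" and nk: "n < k"
  defines "F \<equiv> \<lambda>i j. \<Sum>v | v \<in> K \<and> wlen v = i. \<Sum>w | w \<in> K \<and> wlen w = j.
    cnj (c v) * c w * path_trace k n (word_rev v + w)"
  shows "\<exists>N :: nat \<Rightarrow> real. (\<forall>i. 0 \<le> N i) \<and> (\<forall>i. F i i = of_real ((N i)\<^sup>2)) \<and>
    (\<forall>i j. cmod (F i j) \<le> N i * N j) \<and> (\<forall>u\<in>K. wlen u \<le> n \<longrightarrow> cmod (c u) \<le> N (wlen u))"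
proof -
  define I where "I = {u :: 'x word. wlen u \<le> n} \<times> {..<k} \<times> {..<k}"
  define E :: "'x word \<Rightarrow> 'x word \<times> nat \<times> nat \<Rightarrow> complex"
    where "E v = (\<lambda>(u, p, q). word_eval k (path_mat k u) v $$ (q, p))" for v
  define B where "B i x = (\<Sum>v | v \<in> K \<and> wlen v = i. c v * E v x)" for i x
  define N where "N i = L2_set (\<lambda>x. cmod (B i x)) I" for i
  have fin: "finite I" unfolding I_def using finite_words_le by auto
  have pt: "path_trace k n (word_rev v + w) = (\<Sum>x\<in>I. cnj (E v x) * E w x)" for v w
    unfolding path_trace_rev_add I_def E_def
    by (simp add: sum.cartesian_product case_prod_unfold)
  have F: "F i j = (\<Sum>x\<in>I. cnj (B i x) * B j x)" for i j
  proof -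
    let ?V = "{v. v \<in> K \<and> wlen v = i}" and ?W = "{w. w \<in> K \<and> wlen w = j}"
    have "F i j = (\<Sum>v\<in>?V. \<Sum>w\<in>?W. \<Sum>x\<in>I. cnj (c v * E v x) * (c w * E w x))"
      unfolding F_def pt by (simp add: sum_distrib_left mult_ac)
    also have "\<dots> = (\<Sum>v\<in>?V. \<Sum>x\<in>I. \<Sum>w\<in>?W. cnj (c v * E v x) * (c w * E w x))"
      by (intro sum.cong refl) (rule sum.swap)
    also have "\<dots> = (\<Sum>x\<in>I. \<Sum>v\<in>?V. \<Sum>w\<in>?W. cnj (c v * E v x) * (c w * E w x))"
      by (rule sum.swap)
    also have "\<dots> = (\<Sum>x\<in>I. cnj (B i x) * B j x)"
      by (simp only: B_def cnj_sum sum_product)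
    finally show ?thesis .
  qed
  have "F i i = of_real ((N i)\<^sup>2)" for i
  proof -
    have "(N i)\<^sup>2 = (\<Sum>x\<in>I. (cmod (B i x))\<^sup>2)"
      by (simp add: N_def L2_set_def sum_nonneg)
    then show ?thesis
      by (simp only: F of_real_sum) (intro sum.cong refl, simp only: complex_norm_square mult.commute)
  qed
  moreover have "cmod (F i j) \<le> N i * N j" for i j
  proof -
    have "cmod (F i j) \<le> (\<Sum>x\<in>I. \<bar>cmod (B i x)\<bar> * \<bar>cmod (B j x)\<bar>)"
      unfolding F by (intro sum_norm_le) (simp add: norm_mult)
    also have "\<dots> \<le> N i * N j" unfolding N_def by (rule L2_set_mult_ineq)
    finally show ?thesis .
  qed
  moreover have "cmod (c u) \<le> N (wlen u)" if u: "u \<in> K" "wlen u \<le> n" for u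
  proof -
    \<comment> \<open>An index \<open>(u, p, q)\<close> stands for the entry \<open>(q, p)\<close>,
      so this is row \<open>0\<close> and column \<open>wlen u\<close>, the two ends of the
      path.\<close>
    let ?x = "(u, wlen u, 0::nat)"
    have "B (wlen u) ?x = (\<Sum>v | v \<in> K \<and> wlen v = wlen u. if v = u then c v else 0)"
      unfolding B_def E_def using u nk by (intro sum.cong refl) (auto simp: word_eval_path_mat_ends)
    also have "\<dots> = c u" using K u by simp
    finally have "cmod (c u) = cmod (B (wlen u) ?x)" by simp
    also have "\<dots> \<le> N (wlen u)"
      unfolding N_def using u nk by (intro member_le_L2_set fin) (auto simp: I_def)
    finally show ?thesis .
  qed
  moreover have "0 \<le> N i" for i by (simp add: N_def L2_set_nonneg)
  ultimately show ?thesis by blast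
qed

text \<open>The sum equals \<open>\<tau> (nc_star Q * Q)\<close>, where \<open>Q\<close> is the part
  of \<open>P\<close> of degree at most \<open>d\<close>.\<close>

lemma positive_trace_low_part:
  assumes \<tau>: "ncpoly.positive_trace \<tau>"
  shows "0 \<le> Re (\<Sum>i\<le>d. \<Sum>j\<le>d. \<Sum>v | v \<in> Poly_Mapping.keys P \<and> wlen v = i.
    \<Sum>w | w \<in> Poly_Mapping.keys P \<and> wlen w = j.
    cnj (Poly_Mapping.lookup P v) * Poly_Mapping.lookup P w * \<tau> (Poly_Mapping.single (word_rev v + w) 1))"
proof -
  let ?t = "\<lambda>w. \<tau> (Poly_Mapping.single w 1)"
  define K where "K = {w \<in> Poly_Mapping.keys P. wlen w \<le> d}"
  define Q where "Q = (\<Sum>w\<in>K. Poly_Mapping.single w (Poly_Mapping.lookup P w))"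
  have fin: "finite K" by (simp add: K_def)
  have Q: "Poly_Mapping.lookup Q w = (if w \<in> K then Poly_Mapping.lookup P w else 0)" for w
    using fin by (simp add: Q_def lookup_sum lookup_single when_def)
  have keys: "Poly_Mapping.keys Q = K" by (auto simp: in_keys_iff Q K_def split: if_splits)
  have "\<tau> = word_linear ?t"
    using \<tau> by (intro linear_functional_word_linear) (simp add: ncpoly.positive_trace_def)
  then have "\<tau> (nc_star Q * Q) = word_linear ?t (nc_star Q * Q)" by metis
  also have "\<dots> = (\<Sum>v\<in>K. \<Sum>w\<in>K. cnj (Poly_Mapping.lookup P v) * Poly_Mapping.lookup P w * ?t (word_rev v + w))"
    unfolding word_linear_star_mult keys by (simp add: Q)
  also have "\<dots> = (\<Sum>i\<le>d. \<Sum>j\<le>d. \<Sum>v | v \<in> K \<and> wlen v = i. \<Sum>w | w \<in> K \<and> wlen w = j.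
      cnj (Poly_Mapping.lookup P v) * Poly_Mapping.lookup P w * ?t (word_rev v + w))"
    using fin by (rule sum_group_length) (simp add: K_def)
  also have "\<dots> = (\<Sum>i\<le>d. \<Sum>j\<le>d. \<Sum>v | v \<in> Poly_Mapping.keys P \<and> wlen v = i.
      \<Sum>w | w \<in> Poly_Mapping.keys P \<and> wlen w = j.
      cnj (Poly_Mapping.lookup P v) * Poly_Mapping.lookup P w * ?t (word_rev v + w))"
  proof -
    have "{v. v \<in> K \<and> wlen v = i} = {v. v \<in> Poly_Mapping.keys P \<and> wlen v = i}" if "i \<le> d" for i
      using that by (auto simp: K_def)
    then show ?thesis by (intro sum.cong) auto
  qed
  finally have *: "\<tau> (nc_star Q * Q) = \<dots>" .
  have "0 \<le> \<tau> (nc_star Q * Q)"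
    using \<tau> unfolding ncpoly.positive_trace_def by blast
  then show ?thesis
    unfolding * by (simp only: less_eq_complex_def zero_complex.sel)
qed

text \<open>Conjugation exchanges the two words in the double sum. Positivity in the order on
  complex numbers includes being real, whereas the estimates control only the real part.\<close>

lemma word_linear_self_real:
  assumes "\<And>w. t (word_rev w) = cnj (t w)"
  shows "Im (word_linear t (nc_star P * P)) = 0"
proof -
  let ?f = "\<lambda>v w. cnj (Poly_Mapping.lookup P v) * Poly_Mapping.lookup P w * t (word_rev v + w)"
  have "cnj (?f v w) = ?f w v" for v w
    using assms[of "word_rev v + w"] by (simp add: word_rev_add)
  then have "cnj (word_linear t (nc_star P * P)) = word_linear t (nc_star P * P)"
    unfolding word_linear_star_mult cnj_sum by (simp only:) (rule sum.swap)
  then have "- Im (word_linear t (nc_star P * P)) = Im (word_linear t (nc_star P * P))"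
    by (metis cnj.sel(2))
  then show ?thesis by simp
qed

section \<open>The perturbed functional: positivity and vanishing on identities\<close>

text \<open>Components of degrees \<open>i\<close> and \<open>j\<close> meet in degree
  \<open>i + j\<close>, so the weight appears at the midpoint of \<open>i\<close> and
  \<open>j\<close>; this is why midpoint log-convexity of \<open>r\<close> is the right condition.
  Weights depending only on the length preserve traciality.\<close>

definition perturbed_trace ::
    "('x ncpoly \<Rightarrow> complex) \<Rightarrow> nat \<Rightarrow> nat \<Rightarrow> (nat \<Rightarrow> real) \<Rightarrow> 'x word \<Rightarrow> complex" where
  "perturbed_trace \<tau> k d r w =
     (if wlen w \<le> 2 * d then \<tau> (Poly_Mapping.single w 1) else 0) +
     (if even (wlen w) then of_real ((r (wlen w div 2))\<^sup>2) * path_trace k (2 * d) w else 0)"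

text \<open>An instance of \<open>dominated_form_nonneg\<close> on blocks of equal degree. The
  constant \<open>C\<close> is a crude bound: the squared number of words of length at most
  \<open>2 * d\<close> counts the pairs in a block, and the sum bounds every single value of
  \<open>\<tau>\<close> on such a word.\<close>

lemma perturbed_trace_nonneg:
  fixes \<tau> :: "'x::finite ncpoly \<Rightarrow> complex" and P :: "'x ncpoly"
  assumes \<tau>: "ncpoly.positive_trace \<tau>" and k: "2 * d < k"
    and C: "C = (real (card {w :: 'x word. wlen w \<le> 2 * d}))\<^sup>2 *
      (\<Sum>w :: 'x word | wlen w \<le> 2 * d. cmod (\<tau> (Poly_Mapping.single w 1)))"
    and r: "\<And>i. 0 \<le> r i"
    and r_even: "\<And>i j. even (i + j) \<Longrightarrow> (r ((i + j) div 2))\<^sup>2 \<le> (1/5)^nat_dist i j * (r i * r j)"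
    and r_large: "\<And>i j. d < i \<or> d < j \<Longrightarrow> C \<le> (1/5)^nat_dist i j * (r i * r j)"
  shows "0 \<le> Re (word_linear (perturbed_trace \<tau> k d r) (nc_star P * P))"
proof -
  define K where "K = Poly_Mapping.keys P"
  define c where "c = Poly_Mapping.lookup P"
  define V where "V = {w :: 'x word. wlen w \<le> 2 * d}"
  define M where "M = (\<Sum>w\<in>V. cmod (\<tau> (Poly_Mapping.single w 1)))"
  define S where "S i = {w. w \<in> K \<and> wlen w = i}" for i
  define T where "T i j = (\<Sum>v\<in>S i. \<Sum>w\<in>S j. cnj (c v) * c w * \<tau> (Poly_Mapping.single (word_rev v + w) 1))" for i j
  define F where "F i j = (\<Sum>v\<in>S i. \<Sum>w\<in>S j. cnj (c v) * c w * path_trace k (2 * d) (word_rev v + w))" for i j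
  \<comment> \<open>Including \<open>2 * d\<close> keeps the square \<open>i, j \<le> d\<close>
    inside the range of summation even if \<open>P\<close> has small degree.\<close>
  define n where "n = Max (insert (2 * d) (wlen ` K))"
  have finK: "finite K" by (simp add: K_def)
  have finV: "finite V" by (simp add: V_def finite_words_le)
  have n: "2 * d \<le> n" "\<And>w. w \<in> K \<Longrightarrow> wlen w \<le> n"
    using finK by (auto simp: n_def)
  obtain N :: "nat \<Rightarrow> real" where N: "\<And>i. 0 \<le> N i" "\<And>i. F i i = of_real ((N i)\<^sup>2)"
      "\<And>i j. cmod (F i j) \<le> N i * N j" "\<And>u. u \<in> K \<Longrightarrow> wlen u \<le> 2 * d \<Longrightarrow> cmod (c u) \<le> N (wlen u)"
    using path_trace_gram[OF finK k, of c] unfolding F_def S_def by blast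
  have "word_linear (perturbed_trace \<tau> k d r) (nc_star P * P)
      = (\<Sum>i\<le>n. \<Sum>j\<le>n. \<Sum>v\<in>S i. \<Sum>w\<in>S j. cnj (c v) * c w * perturbed_trace \<tau> k d r (word_rev v + w))"
    unfolding word_linear_star_mult S_def K_def[symmetric] c_def[symmetric]
    using finK n(2) by (rule sum_group_length)
  also have "\<dots> = (\<Sum>i\<le>n. \<Sum>j\<le>n. (if i + j \<le> 2 * d then T i j else 0)
      + (if even (i + j) then of_real ((r ((i + j) div 2))\<^sup>2) * F i j else 0))"
  proof (intro sum.cong refl)
    fix i j
    have "(\<Sum>v\<in>S i. \<Sum>w\<in>S j. cnj (c v) * c w * perturbed_trace \<tau> k d r (word_rev v + w))
      = (\<Sum>v\<in>S i. \<Sum>w\<in>S j.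
          (if i + j \<le> 2 * d then cnj (c v) * c w * \<tau> (Poly_Mapping.single (word_rev v + w) 1) else 0) +
          (if even (i + j) then of_real ((r ((i + j) div 2))\<^sup>2) *
            (cnj (c v) * c w * path_trace k (2 * d) (word_rev v + w)) else 0))"
      by (intro sum.cong refl) (simp add: S_def perturbed_trace_def distrib_left)
    then show "(\<Sum>v\<in>S i. \<Sum>w\<in>S j. cnj (c v) * c w * perturbed_trace \<tau> k d r (word_rev v + w))
      = (if i + j \<le> 2 * d then T i j else 0)
        + (if even (i + j) then of_real ((r ((i + j) div 2))\<^sup>2) * F i j else 0)"
      by (simp add: T_def F_def sum.distrib sum_distrib_left)
  qed
  also have "0 \<le> Re \<dots>"
  proof (rule dominated_form_nonneg[where N = N and C = C, OF n(1) N(1-3) _ _ r_even r_large r])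
    show "0 \<le> Re (\<Sum>i\<le>d. \<Sum>j\<le>d. T i j)"
      unfolding T_def S_def K_def c_def by (rule positive_trace_low_part[OF \<tau>])
    fix i j :: nat assume ij: "i + j \<le> 2 * d"
    have SV: "S i \<subseteq> V" "S j \<subseteq> V" using ij by (auto simp: S_def V_def)
    have M0: "0 \<le> M" by (simp add: M_def sum_nonneg)
    have le: "cmod (cnj (c v) * c w * \<tau> (Poly_Mapping.single (word_rev v + w) 1)) \<le> N i * N j * M"
      if "v \<in> S i" "w \<in> S j" for v w
    proof -
      have "cmod (\<tau> (Poly_Mapping.single (word_rev v + w) 1)) \<le> M"
        unfolding M_def using that ij finV by (intro member_le_sum) (auto simp: V_def S_def)
      \<comment> \<open>Here \<open>i\<close> or \<open>j\<close> may be as large as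
        \<open>2 * d\<close>, which is why the path trace has to detect words up to that length and
        not only up to \<open>d\<close>.\<close>
      moreover have "cmod (c v) \<le> N i" "cmod (c w) \<le> N j"
        using N(4)[of v] N(4)[of w] that ij by (auto simp: S_def)
      ultimately show ?thesis
        by (simp add: norm_mult) (intro mult_mono, use N(1) in auto)
    qed
    have "cmod (T i j) \<le> (\<Sum>v\<in>S i. \<Sum>w\<in>S j. N i * N j * M)"
      unfolding T_def by (intro sum_norm_le le)
    also have "\<dots> = real (card (S i)) * real (card (S j)) * (N i * N j * M)" by simp
    also have "\<dots> \<le> real (card V) * real (card V) * (N i * N j * M)"
      using SV finV M0 N(1) by (intro mult_right_mono mult_mono) (auto intro: card_mono)
    also have "\<dots> = C * (N i * N j)"
      by (simp add: C V_def M_def power2_eq_square mult_ac)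
    finally show "cmod (T i j) \<le> C * (N i * N j)" .
  qed auto
  finally show ?thesis .
qed

text \<open>All words in an identity have length at least \<open>k\<close>, beyond the truncation of
  \<open>\<tau>\<close>, and the path part vanishes degree by degree.\<close>

lemma perturbed_trace_matrix_identities:
  assumes P: "P \<in> matrix_identities k" and k: "2 * d < k"
  shows "word_linear (perturbed_trace \<tau> k d r) P = 0"
proof -
  let ?K = "Poly_Mapping.keys P" and ?c = "Poly_Mapping.lookup P"
  have long: "2 * d < wlen w" if "w \<in> ?K" for w
    using matrix_identities_lookup[OF P, of w] that k by (force simp: in_keys_iff)
  define g where "g m = (if even m then of_real ((r (m div 2))\<^sup>2) else (0::complex))" for m
  have "word_linear (perturbed_trace \<tau> k d r) P = (\<Sum>w\<in>?K. g (wlen w) * (?c w * path_trace k (2 * d) w))"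
    unfolding word_linear_def g_def using long
    by (intro sum.cong refl) (force simp: perturbed_trace_def)
  also have "\<dots> = (\<Sum>m\<in>wlen ` ?K. \<Sum>w | w \<in> ?K \<and> wlen w = m. g (wlen w) * (?c w * path_trace k (2 * d) w))"
    by (rule sum.group[symmetric]) auto
  also have "\<dots> = (\<Sum>m\<in>wlen ` ?K. g m * (\<Sum>w | w \<in> ?K \<and> wlen w = m. ?c w * path_trace k (2 * d) w))"
    by (simp add: sum_distrib_left)
  also have "\<dots> = 0" by (simp add: path_trace_homogeneous[OF P])
  finally show ?thesis .
qed

text \<open>The error \<open>e\<close> is measured before normalisation, and \<open>1 + e 0\<close>
  is the value of the perturbed functional at the unit. The effect of the division is left to the
  passage to the limit.\<close>

lemma approximating_trace:
  fixes \<tau> :: "'x::finite ncpoly \<Rightarrow> complex"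
  assumes \<tau>: "ncpoly.positive_trace \<tau>" and k: "2 * d < k" and \<epsilon>: "0 < \<epsilon>"
  shows "\<exists>e :: 'x word \<Rightarrow> complex.
    ncpoly.positive_trace (word_linear (\<lambda>w. (\<tau> (Poly_Mapping.single w 1) + e w) / (1 + e 0))) \<and>
    (\<forall>P\<in>matrix_identities k. word_linear (\<lambda>w. (\<tau> (Poly_Mapping.single w 1) + e w) / (1 + e 0)) P = 0) \<and>
    (\<forall>w. wlen w \<le> 2 * d \<longrightarrow> cmod (e w) \<le> \<epsilon>)"
proof -
  let ?V = "{w :: 'x word. wlen w \<le> 2 * d}"
  define C where "C = (real (card ?V))\<^sup>2 * (\<Sum>w\<in>?V. cmod (\<tau> (Poly_Mapping.single w 1)))"
  define Y where "Y = 1 + (5^d\<^sup>2)\<^sup>2 * (\<Sum>w\<in>?V. cmod (path_trace k (2 * d) w))"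
  \<comment> \<open>Up to degree \<open>d\<close> the weights are at most
    \<open>s * 5^d\<^sup>2\<close>, so \<open>s\<^sup>2 * Y\<close> bounds the error on words of
    length at most \<open>2 * d\<close>. The summand 1 in \<open>Y\<close> keeps the quotient
    defined.\<close>
  define s where "s = sqrt (\<epsilon> / Y)"
  have C0: "0 \<le> C" by (simp add: C_def sum_nonneg)
  have Y: "1 \<le> Y" by (simp add: Y_def sum_nonneg)
  have s: "0 < s" "s\<^sup>2 * Y = \<epsilon>" using \<epsilon> Y by (auto simp: s_def)
  obtain r :: "nat \<Rightarrow> real" where r0: "\<And>m. 0 < r m" and r_low: "\<And>m. m \<le> d \<Longrightarrow> r m = s * 5^m\<^sup>2"
    and r_even: "\<And>i j. even (i + j) \<Longrightarrow> (r ((i + j) div 2))\<^sup>2 \<le> (1/5)^nat_dist i j * (r i * r j)"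
    and r_large: "\<And>i j. d < i \<or> d < j \<Longrightarrow> C \<le> (1/5)^nat_dist i j * (r i * r j)"
    using weight_exists[OF s(1) C0, of d] by blast
  define t where "t = perturbed_trace \<tau> k d r"
  define e where "e w = t w - \<tau> (Poly_Mapping.single w 1)" for w
  have \<tau>1: "\<tau> 1 = 1"
    using \<tau> by (simp add: ncpoly.positive_trace_def)
  have t0: "t 0 = of_real (1 + (r 0)\<^sup>2 * real (card ?V * k))"
    by (simp add: t_def perturbed_trace_def \<tau>1 path_trace_zero)
  \<comment> \<open>The path trace is nonnegative at the empty word, so the normalising constant is
    a real number that is at least 1.\<close>
  define z where "z = 1 + (r 0)\<^sup>2 * real (card ?V * k)"
  have z: "0 < z" "t 0 = of_real z"
    using t0 by (auto simp: z_def intro!: add_pos_nonneg)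
  have eq: "(\<lambda>w. (\<tau> (Poly_Mapping.single w 1) + e w) / (1 + e 0)) = (\<lambda>w. t w / of_real z)"
    by (simp add: e_def \<tau>1 z)
  have div: "word_linear (\<lambda>w. t w / of_real z) P = word_linear t P / of_real z" for P
    by (simp add: word_linear_def sum_divide_distrib)
  have \<tau>c: "\<tau> (Poly_Mapping.single (u + v) 1) = \<tau> (Poly_Mapping.single (v + u) 1)" for u v
  proof -
    have "\<tau> (Poly_Mapping.single u 1 * Poly_Mapping.single v 1) = \<tau> (Poly_Mapping.single v 1 * Poly_Mapping.single u 1)"
      using \<tau> by (simp only: ncpoly.positive_trace_def)
    then show ?thesis by (simp add: mult_single)
  qed
  have comm: "t (u + v) = t (v + u)" for u v
    using \<tau>c[of u v] path_trace_commute[of k "2 * d" u v]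
    by (simp add: t_def perturbed_trace_def add.commute)
  have herm: "t (word_rev w) = cnj (t w)" for w
    by (simp add: t_def perturbed_trace_def positive_trace_word_rev[OF \<tau>] path_trace_word_rev)
  have "0 \<le> word_linear t (nc_star P * P)" for P
    using word_linear_self_real[of t P, OF herm]
      perturbed_trace_nonneg[where P = P, OF \<tau> k C_def less_imp_le[OF r0] r_even r_large]
    by (simp add: less_eq_complex_def t_def)
  then have pos: "0 \<le> word_linear t (nc_star P * P) / of_real z" for P
    using z(1) by (simp add: less_eq_complex_def)
  have "word_linear (\<lambda>w. t w / of_real z) 1 = 1"
    using z by (simp flip: single_one)
  then have "ncpoly.positive_trace (word_linear (\<lambda>w. t w / of_real z))"
    unfolding ncpoly.positive_trace_def
    using linear_word_linear pos word_linear_commute[of "\<lambda>w. t w / of_real z"] comm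
    by (simp add: div)
  moreover have "word_linear (\<lambda>w. t w / of_real z) P = 0" if "P \<in> matrix_identities k" for P
    unfolding div unfolding t_def using perturbed_trace_matrix_identities[OF that k] by simp
  moreover have "cmod (e w) \<le> \<epsilon>" if w: "wlen w \<le> 2 * d" for w
  proof (cases "even (wlen w)")
    case True
    define m where "m = wlen w div 2"
    have m: "m \<le> d" using w by (simp add: m_def)
    have "cmod (e w) = (r m)\<^sup>2 * cmod (path_trace k (2 * d) w)"
      using True w by (simp add: e_def t_def perturbed_trace_def m_def norm_mult norm_power)
    also have "\<dots> = s\<^sup>2 * ((5^m\<^sup>2)\<^sup>2 * cmod (path_trace k (2 * d) w))"
      by (simp add: r_low[OF m] power_mult_distrib)
    also have "\<dots> \<le> s\<^sup>2 * Y"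
    proof (intro mult_left_mono)
      have "(5^m\<^sup>2)\<^sup>2 * cmod (path_trace k (2 * d) w) \<le> (5^d\<^sup>2)\<^sup>2 * (\<Sum>w\<in>?V. cmod (path_trace k (2 * d) w))"
        using m w finite_words_le
        by (intro mult_mono power_mono power_increasing member_le_sum) auto
      then show "(5^m\<^sup>2)\<^sup>2 * cmod (path_trace k (2 * d) w) \<le> Y" by (simp add: Y_def)
    qed simp
    finally show ?thesis using s by simp
  qed (use w \<epsilon> in \<open>simp add: e_def t_def perturbed_trace_def\<close>)
  ultimately show ?thesis by (intro exI[of _ e]) (simp add: eq)
qed

section \<open>Passage to the limit\<close>

theorem theorem2p4:
  fixes \<tau> :: "('x::finite) ncpoly \<Rightarrow> complex"
  assumes "ncpoly.positive_trace \<tau>"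
  shows "\<exists>\<tau>s :: nat \<Rightarrow> 'x ncpoly \<Rightarrow> complex.
    (\<forall>k\<ge>1. ncpoly.positive_trace (\<tau>s k)) \<and>
    (\<forall>P. (\<lambda>k. \<tau>s k P) \<longlonglongrightarrow> \<tau> P) \<and>
    (\<forall>k\<ge>1. \<forall>P\<in>matrix_identities k. \<tau>s k P = 0)"
proof -
  let ?t = "\<lambda>w. \<tau> (Poly_Mapping.single w 1)"
  define good where "good k e \<longleftrightarrow>
    ncpoly.positive_trace (word_linear (\<lambda>w. (?t w + e w) / (1 + e 0))) \<and>
    (\<forall>P\<in>matrix_identities k. word_linear (\<lambda>w. (?t w + e w) / (1 + e 0)) P = 0) \<and>
    (\<forall>w. wlen w \<le> 2 * ((k - 1) div 2) \<longrightarrow> cmod (e w) \<le> 1 / real k)" for k e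
  have "\<exists>e. good k e" if "k \<ge> 1" for k
  proof -
    \<comment> \<open>\<open>(k - 1) div 2\<close> is the largest \<open>d\<close> with
      \<open>2 * d < k\<close>. It tends to infinity, so every word is eventually covered by the
      error bound.\<close>
    have "2 * ((k - 1) div 2) < k" "0 < 1 / real k" using that by auto
    from approximating_trace[OF assms this] show ?thesis unfolding good_def .
  qed
  then obtain e where e: "\<And>k. k \<ge> 1 \<Longrightarrow> good k (e k)" by metis
  have small: "cmod (e k w) \<le> 1 / real k" if "k \<ge> 1" "wlen w \<le> 2 * ((k - 1) div 2)" for k w
    using e[OF that(1)] that(2) by (simp add: good_def)
  have e0: "(\<lambda>k. e k w) \<longlonglongrightarrow> 0" for w
  proof (rule Lim_null_comparison)
    show "\<forall>\<^sub>F k in sequentially. norm (e k w) \<le> 1 / real k"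
      \<comment> \<open>The offset 2 suffices because \<open>2 * ((k - 1) div 2)\<close> is at least
        \<open>k - 2\<close>.\<close>
      using eventually_ge_at_top[of "wlen w + 2"]
      by eventually_elim (rule small; linarith)
    show "(\<lambda>k. 1 / real k) \<longlonglongrightarrow> 0" by (rule lim_1_over_n)
  qed
  have \<tau>: "\<tau> = word_linear ?t"
    using assms by (intro linear_functional_word_linear) (simp add: ncpoly.positive_trace_def)
  \<comment> \<open>The empty word is covered by \<open>e0\<close> as well, so the normalising
    constants tend to 1.\<close>
  have "(\<lambda>k. (?t w + e k w) / (1 + e k 0)) \<longlonglongrightarrow> (?t w + 0) / (1 + 0)" for w
    by (intro tendsto_intros e0) simp
  then have "(\<lambda>k. word_linear (\<lambda>w. (?t w + e k w) / (1 + e k 0)) P) \<longlonglongrightarrow> word_linear ?t P" for P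
    unfolding word_linear_def by (intro tendsto_intros) simp
  then have "(\<lambda>k. word_linear (\<lambda>w. (?t w + e k w) / (1 + e k 0)) P) \<longlonglongrightarrow> \<tau> P" for P
    by (subst \<tau>)
  then show ?thesis using e unfolding good_def
    by (intro exI[of _ "\<lambda>k. word_linear (\<lambda>w. (?t w + e k w) / (1 + e k 0))"]) auto
qed

end
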